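(* Let $n\ge 1$ be an integer, let $k_0,\dots,k_n\in\mathbb Z_{\ge 0}$, and put $N=n+1+\sum_{i=0}^n k_i$. Let $m=\operatorname{diag}(m_0,\dots,m_n)$ be the real diagonal matrix determined by $m_0+\cdots+m_n=0$ and $$m_{i-1}-m_i+1=\tfrac{n+1}{N}(k_i+1)\qquad (0\le i\le n),$$ where $m_{-1}:=m_n$. Then: (a) $\frac{1}{n+1}(m+\rho)\in \mathring A_k$ for $k=\sum_{i=0}^n k_i$; and (b) the corresponding element of $P_k+\rho$, i.e. $\theta\left(\frac{1}{n+1}(m+\rho)\right)$, is $\left(\sum_{i=1}^n k_i\epsilon_i\right)+\rho$.
   Context: Let $\mathfrak h$ be the space of trace-zero complex diagonal $(n+1)\times(n+1)$ matrices $\operatorname{diag}(h_0,\dots,h_n)$ (the standard Cartan subalgebra of $\mathfrak{sl}_{n+1}\mathbb C$), and let $x_i(\operatorname{diag}(h_0,\dots,h_n))=h_i$. The simple roots are $\alpha_i=x_{i-1}-x_i$ ($1\le i\le n$). Weights are identified with elements of $\mathfrak h$ via the bilinear form $\operatorname{tr}XY$, and the basic weights $\epsilon_1,\dots,\epsilon_n\in\mathfrak h$ are defined by $\alpha_i(\epsilon_j)=\delta_{ij}$. Set $\rho=\operatorname{diag}(\frac n2,\frac n2-1,\dots,-\frac n2)=\epsilon_1+\cdots+\epsilon_n$. The dominant weights are $P_+=\{\sum_{i=1}^n v_i\epsilon_i : v_i\in\mathbb Z_{\ge0}\}$. The dominant weights of level $k$ are $P_k=\{\sum_{i=1}^n v_i\epsilon_i\in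 P_+ : \sum_{i=1}^n v_i\le k\}$. The (fundamental) Weyl alcove is $A=\{\sum_{i=1}^n v_i\epsilon_i : v_i\in\mathbb R,\ v_i\ge 0,\ \sum_{i=1}^n v_i\le 1\}$, with interior $\mathring A$ (given by $v_i>0$ for all $i$ and $\sum_{i=1}^n v_i<1$). Define $\mathring A_k=\left(\frac{1}{k+n+1}P_+\right)\cap\mathring A$. One has $P_k+\rho=P_+\cap(k+n+1)\mathring A$, and $\theta:\mathring A_k\to P_k+\rho$ denotes the resulting bijection $\theta(v)=(k+n+1)v$; "the corresponding element of $P_k+\rho$" means the image under $\theta$. *)

theory Defs
  imports Complex_Main "Jordan_Normal_Form.Matrix"
begin

(* All matrices are (n+1) x (n+1), rows and columns numbered 0..n as in Jordan_Normal_Form. *)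

definition cartan :: "nat \<Rightarrow> complex mat set" where
  "cartan n = {X \<in> carrier_mat (n + 1) (n + 1). diagonal_mat X \<and> (\<Sum>i\<le>n. X $$ (i, i)) = 0}"

definition coord :: "nat \<Rightarrow> complex mat \<Rightarrow> complex" where
  "coord i X = X $$ (i, i)"

(* Meant for 1 \<le> i \<le> n. *)
definition simple_root :: "nat \<Rightarrow> complex mat \<Rightarrow> complex" where
  "simple_root i X = coord (i - 1) X - coord i X"

(* The basis of the Cartan subalgebra dual to the simple roots; existence and uniqueness
   for 1 \<le> j \<le> n are shown in basic_weight_ex1 below. *)
definition basic_weight :: "nat \<Rightarrow> nat \<Rightarrow> complex mat" where
  "basic_weight n j =
    (THE E. E \<in> cartan n \<and> (\<forall>i\<in>{1..n}. simple_root i E = (if i = j then 1 else 0)))"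

definition rho :: "nat \<Rightarrow> complex mat" where
  "rho n = mat_diag (n + 1) (\<lambda>i. of_nat n / 2 - of_nat i)"

(* Types of matrices carry no dimension and hence have no zero element, so the sum
   is the one of the module of (n+1) x (n+1) matrices. *)
definition weight_comb :: "nat \<Rightarrow> (nat \<Rightarrow> complex) \<Rightarrow> complex mat" where
  "weight_comb n v =
    finsum (module_mat TYPE(complex) (n + 1) (n + 1)) (\<lambda>i. v i \<cdot>\<^sub>m basic_weight n i) {1..n}"

definition dominant_weights :: "nat \<Rightarrow> complex mat set" where
  "dominant_weights n = {weight_comb n (\<lambda>i. of_nat (v i)) | v :: nat \<Rightarrow> nat. True}"

definition dominant_weights_level :: "nat \<Rightarrow> nat \<Rightarrow> complex mat set" where
  "dominant_weights_level n k =
    {weight_comb n (\<lambda>i. of_nat (v i)) | v :: nat \<Rightarrow> nat. (\<Sum>i=1..n. v i) \<le> k}"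

definition alcove_interior :: "nat \<Rightarrow> complex mat set" where
  "alcove_interior n =
    {weight_comb n (\<lambda>i. of_real (v i)) | v :: nat \<Rightarrow> real.
      (\<forall>i\<in>{1..n}. v i > 0) \<and> (\<Sum>i=1..n. v i) < 1}"

definition alcove_interior_level :: "nat \<Rightarrow> nat \<Rightarrow> complex mat set" where
  "alcove_interior_level n k =
    (\<lambda>X. (1 / of_nat (k + n + 1)) \<cdot>\<^sub>m X) ` dominant_weights n \<inter> alcove_interior n"

(* Only its values on alcove_interior_level n k matter; see theta_bij below. *)
definition theta :: "nat \<Rightarrow> nat \<Rightarrow> complex mat \<Rightarrow> complex mat" where
  "theta n k X = of_nat (k + n + 1) \<cdot>\<^sub>m X"


lemma cartan_eqI:
  assumes X: "X \<in> cartan n" and Y: "Y \<in> cartan n"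
    and eq: "\<And>i. i \<in> {1..n} \<Longrightarrow> simple_root i X = simple_root i Y"
  shows "X = Y"
proof -
  have d: "X $$ (i, i) - Y $$ (i, i) = X $$ (0, 0) - Y $$ (0, 0)" if "i \<le> n" for i
    using that
  proof (induction i)
    case (Suc i)
    have "simple_root (Suc i) X = simple_root (Suc i) Y" using eq[of "Suc i"] Suc.prems by simp
    then have "X $$ (i, i) - X $$ (Suc i, Suc i) = Y $$ (i, i) - Y $$ (Suc i, Suc i)"
      by (simp add: simple_root_def coord_def)
    then have "X $$ (Suc i, Suc i) - Y $$ (Suc i, Suc i) = X $$ (i, i) - Y $$ (i, i)"
      by (simp add: algebra_simps)
    then show ?case using Suc by simp
  qed simp
  have "0 = (\<Sum>i\<le>n. X $$ (i, i) - Y $$ (i, i))"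
    using X Y by (simp add: cartan_def sum_subtractf)
  also have "\<dots> = (\<Sum>i\<le>n. X $$ (0, 0) - Y $$ (0, 0))" by (rule sum.cong[OF refl], rule d) simp
  also have "\<dots> = of_nat (n + 1) * (X $$ (0, 0) - Y $$ (0, 0))" by simp
  finally have "X $$ (0, 0) - Y $$ (0, 0) = 0"
    by (metis mult_eq_0_iff of_nat_eq_0_iff Suc_eq_plus1 nat.simps(3))
  then have e: "X $$ (i, i) = Y $$ (i, i)" if "i \<le> n" for i using d[OF that] by simp
  show ?thesis
  proof (rule eq_matI)
    show "dim_row X = dim_row Y" "dim_col X = dim_col Y" using X Y by (auto simp: cartan_def)
    fix i j assume "i < dim_row Y" "j < dim_col Y"
    then have "i \<le> n" "j \<le> n" using Y by (auto simp: cartan_def)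
    then show "X $$ (i, j) = Y $$ (i, j)"
      using X Y e by (cases "i = j") (auto simp: cartan_def diagonal_mat_def)
  qed
qed

lemma basic_weight_ex1:
  assumes j: "j \<in> {1..n}"
  shows "\<exists>!E. E \<in> cartan n \<and> (\<forall>i\<in>{1..n}. simple_root i E = (if i = j then 1 else 0))"
proof -
  define f :: "nat \<Rightarrow> complex" where "f i = (if i < j then 1 else 0) - of_nat j / of_nat (n + 1)" for i
  define E where "E = mat_diag (n + 1) f"
  have "(\<Sum>i\<le>n. f i) = (\<Sum>i\<le>n. if i < j then 1 else 0) - of_nat j"
  proof -
    have "(\<Sum>i\<le>n. of_nat j / of_nat (n + 1) :: complex) = of_nat j"
      by (simp del: of_nat_Suc)
    then show ?thesis unfolding f_def sum_subtractf by simp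
  qed
  also have "(\<Sum>i\<le>n. if i < j then 1 else 0 :: complex) = (\<Sum>i<j. 1)"
    using j by (intro sum.mono_neutral_cong_right) auto
  finally have "(\<Sum>i\<le>n. f i) = 0" by simp
  then have E: "E \<in> cartan n"
    by (simp add: E_def cartan_def mat_diag_def diagonal_mat_def)
  have sr: "simple_root i E = (if i = j then 1 else 0)" if "i \<in> {1..n}" for i
    using that j by (auto simp: E_def simple_root_def coord_def mat_diag_def f_def)
  show ?thesis
  proof (intro ex1I[of _ E])
    fix Y assume Y: "Y \<in> cartan n \<and> (\<forall>i\<in>{1..n}. simple_root i Y = (if i = j then 1 else 0))"
    show "Y = E"
      by (rule cartan_eqI[of _ n]) (use Y E sr in simp_all)
  qed (use E sr in blast)
qed

lemma basic_weight:
  assumes "j \<in> {1..n}"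
  shows "basic_weight n j \<in> cartan n"
    "\<And>i. i \<in> {1..n} \<Longrightarrow> simple_root i (basic_weight n j) = (if i = j then 1 else 0)"
  using theI'[OF basic_weight_ex1[OF assms]] unfolding basic_weight_def by auto

lemma finsum_module_mat:
  fixes f :: "nat \<Rightarrow> complex mat"
  assumes "finite F" and "\<And>i. i \<in> F \<Longrightarrow> f i \<in> carrier_mat r c"
  shows "finsum (module_mat TYPE(complex) r c) f F = mat r c (\<lambda>ij. \<Sum>i\<in>F. f i $$ ij)"
  using assms
proof (induction F)
  interpret abelian_group "module_mat TYPE(complex) r c" by (rule abelian_group_mat)
  {
    case empty
    then show ?case by (simp add: finsum_empty module_mat_simps) (auto intro!: eq_matI)
  next
    case (insert x F)
    then have "finsum (module_mat TYPE(complex) r c) f (insert x F)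
      = f x + finsum (module_mat TYPE(complex) r c) f F"
      by (subst finsum_insert) (auto simp: module_mat_simps)
    with insert show ?case by (auto intro!: eq_matI)
  }
qed

lemma weight_comb_carrier [simp]: "weight_comb n v \<in> carrier_mat (n + 1) (n + 1)"
  and weight_comb_index: "i \<le> n \<Longrightarrow> j \<le> n \<Longrightarrow>
    weight_comb n v $$ (i, j) = (\<Sum>l=1..n. v l * basic_weight n l $$ (i, j))"
proof -
  have c: "basic_weight n l \<in> carrier_mat (n + 1) (n + 1)" if "l \<in> {1..n}" for l
    using basic_weight(1)[OF that] by (simp add: cartan_def)
  then have e: "weight_comb n v = mat (n + 1) (n + 1) (\<lambda>ij. \<Sum>l=1..n. (v l \<cdot>\<^sub>m basic_weight n l) $$ ij)"
    unfolding weight_comb_def by (intro finsum_module_mat) auto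
  then show "weight_comb n v \<in> carrier_mat (n + 1) (n + 1)" by simp
  assume "i \<le> n" "j \<le> n"
  then have "(v l \<cdot>\<^sub>m basic_weight n l) $$ (i, j) = v l * basic_weight n l $$ (i, j)"
    if "l \<in> {1..n}" for l using c[OF that] by simp
  then show "weight_comb n v $$ (i, j) = (\<Sum>l=1..n. v l * basic_weight n l $$ (i, j))"
    using \<open>i \<le> n\<close> \<open>j \<le> n\<close> by (simp add: e)
qed

lemma weight_comb_in_cartan: "weight_comb n v \<in> cartan n"
proof -
  have "(\<Sum>i\<le>n. \<Sum>l=1..n. v l * basic_weight n l $$ (i, i)) =
      (\<Sum>l=1..n. v l * (\<Sum>i\<le>n. basic_weight n l $$ (i, i)))"
    by (subst sum.swap) (simp add: sum_distrib_left)
  also have "\<dots> = 0" using basic_weight(1) by (intro sum.neutral) (auto simp: cartan_def)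
  finally have tr: "(\<Sum>i\<le>n. weight_comb n v $$ (i, i)) = 0" by (simp add: weight_comb_index)
  have "weight_comb n v $$ (i, j) = 0" if "i \<le> n" "j \<le> n" "i \<noteq> j" for i j
  proof -
    have "basic_weight n l $$ (i, j) = 0" if "l \<in> {1..n}" for l
      using basic_weight(1)[OF that] \<open>i \<le> n\<close> \<open>j \<le> n\<close> \<open>i \<noteq> j\<close>
      by (auto simp: cartan_def diagonal_mat_def)
    then show ?thesis using that by (simp add: weight_comb_index)
  qed
  then show ?thesis using tr weight_comb_carrier[of n v] by (auto simp: cartan_def diagonal_mat_def)
qed

lemma simple_root_weight_comb:
  assumes "i \<in> {1..n}"
  shows "simple_root i (weight_comb n v) = v i"
proof -
  have "simple_root i (weight_comb n v) = (\<Sum>l=1..n. v l * simple_root i (basic_weight n l))"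
    using assms
    by (auto simp: simple_root_def coord_def weight_comb_index sum_subtractf right_diff_distrib)
  also have "\<dots> = (\<Sum>l=1..n. if l = i then v l else 0)"
    using assms by (intro sum.cong) (auto simp: basic_weight(2))
  finally show ?thesis using assms by simp
qed

lemma smult_weight_comb: "c \<cdot>\<^sub>m weight_comb n v = weight_comb n (\<lambda>i. c * v i)"
  using weight_comb_carrier[of n v] weight_comb_carrier[of n "\<lambda>i. c * v i"]
  by (intro eq_matI) (auto simp: weight_comb_index sum_distrib_left mult.assoc)

lemma weight_comb_eq_iff: "weight_comb n v = weight_comb n w \<longleftrightarrow> (\<forall>i\<in>{1..n}. v i = w i)"
proof
  show "\<forall>i\<in>{1..n}. v i = w i" if "weight_comb n v = weight_comb n w"
    using simple_root_weight_comb[of _ n v] simple_root_weight_comb[of _ n w] that by simp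
  show "weight_comb n v = weight_comb n w" if "\<forall>i\<in>{1..n}. v i = w i"
    by (rule cartan_eqI[OF weight_comb_in_cartan weight_comb_in_cartan])
      (use that in \<open>simp add: simple_root_weight_comb\<close>)
qed

lemma rho_eq: "rho n = weight_comb n (\<lambda>_. 1)"
proof (rule cartan_eqI[OF _ weight_comb_in_cartan])
  have "(\<Sum>i\<le>n. of_nat i :: complex) = of_nat n * (of_nat n + 1) / 2"
    by (induction n) (auto simp: field_simps)
  then have "(\<Sum>i\<le>n. of_nat n / 2 - of_nat i :: complex) = 0"
    unfolding sum_subtractf by (simp add: field_simps)
  then show "rho n \<in> cartan n"
    by (simp add: rho_def cartan_def mat_diag_def diagonal_mat_def)
  show "simple_root i (rho n) = simple_root i (weight_comb n (\<lambda>_. 1))" if "i \<in> {1..n}" for i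
    using that unfolding simple_root_weight_comb[OF that]
    by (auto simp: simple_root_def coord_def rho_def mat_diag_def of_nat_diff)
qed

lemma weight_comb_add_rho: "weight_comb n v + rho n = weight_comb n (\<lambda>i. v i + 1)"
proof -
  have d: "dim_row (weight_comb n w) = n + 1" "dim_col (weight_comb n w) = n + 1" for w
    using weight_comb_carrier[of n w] by auto
  show ?thesis
    unfolding rho_eq
    by (intro eq_matI) (simp_all add: d weight_comb_index sum.distrib distrib_right)
qed

lemma theta_bij:
  "bij_betw (theta n k) (alcove_interior_level n k) ((\<lambda>X. X + rho n) ` dominant_weights_level n k)"
proof (rule bij_betw_imageI)
  let ?K = "k + n + 1"
  have K: "(of_nat ?K :: complex) \<noteq> 0" unfolding of_nat_eq_0_iff by simp
  have inv: "(1 / of_nat ?K) \<cdot>\<^sub>m theta n k X = X" for X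
    using K by (auto simp: theta_def intro!: eq_matI simp del: of_nat_add of_nat_Suc)
  show "inj_on (theta n k) (alcove_interior_level n k)" 
    by (intro inj_onI) (metis inv)
  show "theta n k ` alcove_interior_level n k = (\<lambda>X. X + rho n) ` dominant_weights_level n k"
  proof (intro equalityI subsetI)
    fix Y assume "Y \<in> theta n k ` alcove_interior_level n k"
    then obtain w :: "nat \<Rightarrow> nat" and u :: "nat \<Rightarrow> real" where
      w: "Y = theta n k ((1 / of_nat ?K) \<cdot>\<^sub>m weight_comb n (\<lambda>i. of_nat (w i)))"
      and wu: "(1 / of_nat ?K) \<cdot>\<^sub>m weight_comb n (\<lambda>i. of_nat (w i)) = weight_comb n (\<lambda>i. of_real (u i))"
      and u: "\<forall>i\<in>{1..n}. u i > 0" "(\<Sum>i=1..n. u i) < 1"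
      by (fastforce simp: alcove_interior_level_def alcove_interior_def dominant_weights_def)
    have Y: "Y = weight_comb n (\<lambda>i. of_nat (w i))"
      using K by (simp add: w theta_def smult_weight_comb del: of_nat_add of_nat_Suc)
    have ui: "u i = real (w i) / real ?K" if "i \<in> {1..n}" for i
    proof -
      have "complex_of_real (u i) = of_nat (w i) / of_nat ?K"
        using wu that unfolding smult_weight_comb weight_comb_eq_iff by force
      also have "\<dots> = complex_of_real (real (w i) / real ?K)" by simp
      finally show ?thesis using of_real_eq_iff by blast
    qed
    have pos: "w i \<ge> 1" if "i \<in> {1..n}" for i
    proof -
      have "0 < real (w i) / real ?K" using u(1) that ui[OF that] by metis
      then show ?thesis by (cases "w i = 0") auto
    qed
    have "(\<Sum>i=1..n. real (w i)) / real ?K < 1"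
      using u(2) ui by (simp add: sum_divide_distrib)
    then have "real (\<Sum>i=1..n. w i) < real ?K" by (simp add: field_simps)
    then have lt: "(\<Sum>i=1..n. w i) < ?K" using of_nat_less_iff by blast
    have "(\<Sum>i=1..n. w i) = (\<Sum>i=1..n. (w i - 1) + 1)" by (rule sum.cong) (use pos in force)+
    also have "\<dots> = (\<Sum>i=1..n. w i - 1) + n" by (simp only: sum.distrib) simp
    finally have "(\<Sum>i=1..n. w i - 1) \<le> k" using lt by linarith
    moreover have "Y = weight_comb n (\<lambda>i. of_nat (w i - 1)) + rho n"
      unfolding Y weight_comb_add_rho weight_comb_eq_iff using pos by (auto simp: of_nat_diff)
    ultimately show "Y \<in> (\<lambda>X. X + rho n) ` dominant_weights_level n k"
      by (force simp: dominant_weights_level_def)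
  next
    fix Y assume "Y \<in> (\<lambda>X. X + rho n) ` dominant_weights_level n k"
    then obtain v :: "nat \<Rightarrow> nat" where v: "Y = weight_comb n (\<lambda>i. of_nat (v i)) + rho n"
      "(\<Sum>i=1..n. v i) \<le> k"
      by (auto simp: dominant_weights_level_def)
    have Y: "Y = weight_comb n (\<lambda>i. of_nat (v i + 1))" unfolding v(1) weight_comb_add_rho
      by (simp add: add.commute)
    define X where "X = (1 / of_nat ?K) \<cdot>\<^sub>m Y"
    have "X \<in> (\<lambda>X. (1 / of_nat ?K) \<cdot>\<^sub>m X) ` dominant_weights n"
      unfolding X_def Y dominant_weights_def
      by (rule imageI, rule CollectI, rule exI[of _ "\<lambda>i. v i + 1"]) simp
    moreover have "X \<in> alcove_interior n"
    proof -
      let ?u = "\<lambda>i. real (v i + 1) / real ?K"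
      have "(\<Sum>i=1..n. ?u i) = (real (\<Sum>i=1..n. v i) + n) / ?K"
        by (simp add: sum_divide_distrib[symmetric] sum.distrib)
      also have "\<dots> < 1" using v(2) by (simp add: of_nat_sum[symmetric] del: of_nat_sum)
      finally have "(\<Sum>i=1..n. ?u i) < 1" .
      moreover have "X = weight_comb n (\<lambda>i. of_real (?u i))"
        unfolding X_def Y smult_weight_comb by simp
      ultimately show ?thesis unfolding alcove_interior_def
        by (intro CollectI exI[of _ ?u]) auto
    qed
    moreover have "Y = theta n k X"
      using K by (auto simp: X_def theta_def intro!: eq_matI simp del: of_nat_add of_nat_Suc)
    ultimately show "Y \<in> theta n k ` alcove_interior_level n k"
      by (auto simp: alcove_interior_level_def)
  qed
qed

(* The system of equations that determines the matrix m of the theorem has a solution,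
   and only one. *)
lemma diag_system_ex:
  fixes r :: "nat \<Rightarrow> real"
  assumes r: "(\<Sum>i\<le>n. r i) = real (n + 1)"
  shows "\<exists>m. (\<Sum>i\<le>n. m i) = 0 \<and> (\<forall>i\<le>n. (if i = 0 then m n else m (i - 1)) - m i + 1 = r i)"
proof -
  define a where "a j = (\<Sum>i=1..j. 1 - r i)" for j
  define c where "c = (\<Sum>j\<le>n. a j) / real (n + 1)"
  have "{..n} = insert 0 {1..n}" by auto
  then have "(\<Sum>i\<le>n. r i) = r 0 + (\<Sum>i=1..n. r i)" by simp
  then have an: "a n + 1 = r 0" using r by (simp add: a_def sum_subtractf)
  have "(\<Sum>j\<le>n. a j - c) = 0" by (simp add: sum_subtractf c_def del: of_nat_Suc)
  moreover have "(if i = 0 then a n - c else a (i - 1) - c) - (a i - c) + 1 = r i" if "i \<le> n" for i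
    using an by (cases i) (auto simp: a_def)
  ultimately show ?thesis by (intro exI[of _ "\<lambda>i. a i - c"]) auto
qed

lemma diag_system_unique:
  fixes r m m' :: "nat \<Rightarrow> real"
  assumes m: "(\<Sum>i\<le>n. m i) = 0 \<and> (\<forall>i\<le>n. (if i = 0 then m n else m (i - 1)) - m i + 1 = r i)"
    and m': "(\<Sum>i\<le>n. m' i) = 0 \<and> (\<forall>i\<le>n. (if i = 0 then m' n else m' (i - 1)) - m' i + 1 = r i)"
    and i: "i \<le> n"
  shows "m i = m' i"
proof -
  have d: "m j - m' j = m 0 - m' 0" if "j \<le> n" for j
    using that
  proof (induction j)
    case (Suc j)
    have "m j - m (Suc j) + 1 = r (Suc j)" "m' j - m' (Suc j) + 1 = r (Suc j)"
      using conjunct2[OF m, rule_format, of "Suc j"] conjunct2[OF m', rule_format, of "Suc j"]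
        Suc.prems by auto
    then show ?case using Suc by simp
  qed simp
  have "0 = (\<Sum>j\<le>n. m j - m' j)" using m m' by (simp add: sum_subtractf)
  also have "\<dots> = (\<Sum>j\<le>n. m 0 - m' 0)" by (rule sum.cong[OF refl], rule d) simp
  also have "\<dots> = real (n + 1) * (m 0 - m' 0)" by simp
  finally show "m i = m' i" using d[OF i] by simp
qed

end

theory Submission
  imports Defs
begin

text \<open>
  A trace-zero diagonal matrix is determined by its simple root values, and these are its
  coordinates in the basis of basic weights. The equations for \<open>1 \<le> i \<le> n\<close> say that the
  \<open>i\<close>-th simple root takes the value \<open>(n + 1) / N * (k i + 1) - 1\<close> on \<open>m\<close>. It takes the
  value \<open>1\<close> on \<open>\<rho>\<close>, so adding \<open>\<rho>\<close> cancels the \<open>- 1\<close>, and dividing by \<open>n + 1\<close> leaves the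
  coordinates \<open>(k i + 1) / N\<close>. Thus the matrix of the theorem is \<open>1 / N\<close> times
  \<open>(\<Sum>i=1..n. k i * \<epsilon> i) + \<rho>\<close>. Since \<open>N\<close> is the factor of \<open>\<theta>\<close> at the level
  \<open>k 0 + \<dots> + k n\<close>, this is exactly the preimage under \<open>\<theta>\<close> of that shifted weight, which
  gives (b).

  For (a), the weight has level at most \<open>k 1 + \<dots> + k n \<le> k 0 + \<dots> + k n\<close>, so the
  surjectivity part of \<open>theta_bij\<close> puts its preimage into the alcove.
\<close>

text \<open>
  The coordinates with respect to a basis are the values of the dual basis.
\<close>
lemma cartan_eq_weight_comb:
  assumes "X \<in> cartan n"
  shows "X = weight_comb n (\<lambda>i. simple_root i X)"
  by (rule cartan_eqI[OF assms weight_comb_in_cartan]) (simp add: simple_root_weight_comb)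

lemma mat_diag_in_cartan:
  assumes "(\<Sum>i\<le>n. f i) = 0"
  shows "mat_diag (n + 1) f \<in> cartan n"
  using assms by (simp add: cartan_def mat_diag_def diagonal_mat_def)

lemma simple_root_mat_diag:
  assumes "i \<in> {1..n}"
  shows "simple_root i (mat_diag (n + 1) f) = f (i - 1) - f i"
  using assms by (auto simp: simple_root_def coord_def mat_diag_def)

lemma theta_smult_inverse:
  "theta n k ((1 / of_nat (k + n + 1)) \<cdot>\<^sub>m X) = X"
  "(1 / of_nat (k + n + 1)) \<cdot>\<^sub>m theta n k X = X"
proof -
  have "(of_nat (k + n + 1) :: complex) \<noteq> 0" unfolding of_nat_eq_0_iff by simp
  then show "theta n k ((1 / of_nat (k + n + 1)) \<cdot>\<^sub>m X) = X"
    "(1 / of_nat (k + n + 1)) \<cdot>\<^sub>m theta n k X = X"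
    by (auto simp: theta_def intro!: eq_matI simp del: of_nat_add of_nat_Suc)
qed

text \<open>
  Since \<open>\<theta>\<close> is a rescaling, its inverse is known on all matrices, and \<open>theta_bij\<close>
  then says which points the alcove contains.
\<close>
lemma shifted_dominant_weight_in_alcove:
  assumes "Y \<in> dominant_weights_level n k"
  shows "(1 / of_nat (k + n + 1)) \<cdot>\<^sub>m (Y + rho n) \<in> alcove_interior_level n k"
proof -
  obtain X where "X \<in> alcove_interior_level n k" "Y + rho n = theta n k X"
    using assms theta_bij[of n k] unfolding bij_betw_def by blast
  then show ?thesis by (simp only: theta_smult_inverse)
qed

theorem theorem4p4:
  fixes n N :: nat and k :: "nat \<Rightarrow> nat" and m :: "nat \<Rightarrow> real" and M :: "complex mat"
  assumes "n \<ge> 1"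
    and "N = n + 1 + (\<Sum>i\<le>n. k i)"
    and "(\<Sum>i\<le>n. m i) = 0"
    and "\<And>i. i \<le> n \<Longrightarrow>
      (if i = 0 then m n else m (i - 1)) - m i + 1 = real (n + 1) / real N * (real (k i) + 1)"
    and "M = mat_diag (n + 1) (\<lambda>i. complex_of_real (m i))"
  shows "(1 / of_nat (n + 1)) \<cdot>\<^sub>m (M + rho n) \<in> alcove_interior_level n (\<Sum>i\<le>n. k i) \<and>
    theta n (\<Sum>i\<le>n. k i) ((1 / of_nat (n + 1)) \<cdot>\<^sub>m (M + rho n))
      = weight_comb n (\<lambda>i. of_nat (k i)) + rho n"
proof -
  let ?K = "\<Sum>i\<le>n. k i"
  let ?Y = "weight_comb n (\<lambda>i. of_nat (k i))"
  have N: "?K + n + 1 = N" using assms(2) by simp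
  have "(\<Sum>i\<le>n. complex_of_real (m i)) = 0"
    using assms(3) by (simp flip: of_real_sum)
  then have "M \<in> cartan n" unfolding assms(5) by (rule mat_diag_in_cartan)
  then have "M + rho n = weight_comb n (\<lambda>i. simple_root i M + 1)"
    by (metis cartan_eq_weight_comb weight_comb_add_rho)
  then have "(1 / of_nat (n + 1)) \<cdot>\<^sub>m (M + rho n) =
      weight_comb n (\<lambda>i. 1 / of_nat (n + 1) * (simple_root i M + 1))"
    by (simp only: smult_weight_comb)
  also have "\<dots> = weight_comb n (\<lambda>i. 1 / of_nat N * (of_nat (k i) + 1))"
    unfolding weight_comb_eq_iff
  proof
    fix i assume i: "i \<in> {1..n}"
    have "simple_root i M + 1 = complex_of_real (m (i - 1) - m i + 1)"
      using i unfolding assms(5) by (simp add: simple_root_mat_diag del: One_nat_def)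
    also have "m (i - 1) - m i + 1 = real (n + 1) / real N * (real (k i) + 1)"
      using assms(4)[of i] i by auto
    also have "complex_of_real \<dots> = of_nat (n + 1) / of_nat N * (of_nat (k i) + 1)"
      by simp
    finally have "simple_root i M + 1 = of_nat (n + 1) / of_nat N * (of_nat (k i) + 1)" .
    moreover have "(of_nat (n + 1) :: complex) \<noteq> 0" unfolding of_nat_eq_0_iff by simp
    ultimately show "1 / of_nat (n + 1) * (simple_root i M + 1) =
        1 / of_nat N * (of_nat (k i) + 1)"
      by (simp del: of_nat_add of_nat_Suc)
  qed
  also have "\<dots> = (1 / of_nat (?K + n + 1)) \<cdot>\<^sub>m (?Y + rho n)"
    by (simp only: N smult_weight_comb weight_comb_add_rho)
  finally have X: "(1 / of_nat (n + 1)) \<cdot>\<^sub>m (M + rho n) =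
      (1 / of_nat (?K + n + 1)) \<cdot>\<^sub>m (?Y + rho n)" .
  have "(\<Sum>i=1..n. k i) \<le> ?K" by (intro sum_mono2) auto
  then have "?Y \<in> dominant_weights_level n ?K"
    by (auto simp: dominant_weights_level_def)
  then show ?thesis unfolding X
    by (intro conjI shifted_dominant_weight_in_alcove theta_smult_inverse(1))
qed

end
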